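(* Let $n\ge1$ and $\theta_*\in\mathbb{R}^d$ with $\|\theta_*\|\le\frac{1}{\sqrt2}$, and suppose that $\theta_*$ is known to the estimator. For $\delta\in[0,1]$ let $U_i=\|\theta_*\|S_i+W_i$, $1\le i\le n$, where $W_i\sim N(0,1)$ are i.i.d. and independent of the sign chain $S_0^n$ with flip probability $\delta$. Then $$\inf_{\hat\delta(U_1^n)}\ \sup_{\delta\in[0,1]}\ \mathbb{E}\big[|\delta-\hat\delta(U_1^n)|\big]\ \ge\ \frac{1}{32\sqrt n},$$ where the infimum is over all estimators $\hat\delta(U_1^n)$, i.e. measurable functions of $U_1^n=(U_1,\dots,U_n)$ (which may depend on $\theta_*$).
   Context: $S_0,S_1,\dots,S_n\in\{-1,1\}$ is a Markov chain with $\mathbb{P}[S_0=1]=\frac12$ and, for $i\ge1$, $S_i=S_{i-1}$ with probability $1-\delta$ and $S_i=-S_{i-1}$ with probability $\delta$. $\|\cdot\|$ is the Euclidean norm. *)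

theory Defs
  imports "HOL-Probability.Probability"
begin

(* Conditioning is on the whole past, which also expresses the Markov property; pasts of
   probability zero are excluded since cond_prob is then 0 by the convention x / 0 = 0. *)
locale sign_chain = prob_space M for M :: "'w measure" +
  fixes n :: nat and \<delta> :: real and S :: "nat \<Rightarrow> 'w \<Rightarrow> real"
  assumes S_measurable: "\<And>i. i \<le> n \<Longrightarrow> S i \<in> borel_measurable M"
    and S_sign: "\<And>i \<omega>. i \<le> n \<Longrightarrow> \<omega> \<in> space M \<Longrightarrow> S i \<omega> \<in> {-1, 1}"
    and S_initial: "\<P>(\<omega> in M. S 0 \<omega> = 1) = 1 / 2"
    and S_stay: "\<And>i s. \<lbrakk>1 \<le> i; i \<le> n; \<P>(\<omega> in M. \<forall>j<i. S j \<omega> = s j) > 0\<rbrakk> \<Longrightarrow>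
      \<P>(\<omega> in M. S i \<omega> = S (i - 1) \<omega> \<bar> \<forall>j<i. S j \<omega> = s j) = 1 - \<delta>"
    and S_flip: "\<And>i s. \<lbrakk>1 \<le> i; i \<le> n; \<P>(\<omega> in M. \<forall>j<i. S j \<omega> = s j) > 0\<rbrakk> \<Longrightarrow>
      \<P>(\<omega> in M. S i \<omega> = - S (i - 1) \<omega> \<bar> \<forall>j<i. S j \<omega> = s j) = \<delta>"

locale noisy_sign_chain = sign_chain M n \<delta> S
  for M :: "'w measure" and n :: nat and \<delta> :: real and S :: "nat \<Rightarrow> 'w \<Rightarrow> real" +
  fixes W :: "nat \<Rightarrow> 'w \<Rightarrow> real"
  assumes W_normal: "\<And>i. i \<in> {1..n} \<Longrightarrow> distributed M lborel (W i) std_normal_density"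
    and W_indep: "indep_vars (\<lambda>_. borel) W {1..n}"
    and S_W_indep: "indep_var (Pi\<^sub>M {0..n} (\<lambda>_. borel)) (\<lambda>\<omega>. \<lambda>i\<in>{0..n}. S i \<omega>)
                              (Pi\<^sub>M {1..n} (\<lambda>_. borel)) (\<lambda>\<omega>. \<lambda>i\<in>{1..n}. W i \<omega>)"

definition observation ::
    "'d::real_normed_vector \<Rightarrow> nat \<Rightarrow> (nat \<Rightarrow> 'w \<Rightarrow> real) \<Rightarrow> (nat \<Rightarrow> 'w \<Rightarrow> real) \<Rightarrow> 'w \<Rightarrow> nat \<Rightarrow> real"
  where "observation \<theta> n S W \<omega> = (\<lambda>i\<in>{1..n}. norm \<theta> * S i \<omega> + W i \<omega>)"

definition estimators :: "nat \<Rightarrow> ((nat \<Rightarrow> real) \<Rightarrow> real) set"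
  where "estimators n = borel_measurable (Pi\<^sub>M {1..n} (\<lambda>_. borel))"

(* The risk is an integral in [0, \<infinity>], so an estimator whose error is not integrable has infinite
   risk; the Bochner integral would give it risk 0. *)
definition abs_risk :: "'w measure \<Rightarrow> ('w \<Rightarrow> nat \<Rightarrow> real) \<Rightarrow> real \<Rightarrow> ((nat \<Rightarrow> real) \<Rightarrow> real) \<Rightarrow> ennreal"
  where "abs_risk M U \<delta> est = (\<integral>\<^sup>+ \<omega>. ennreal \<bar>\<delta> - est (U \<omega>)\<bar> \<partial>M)"

end

theory Submission
  imports Defs
begin

text \<open>
  Le Cam's two-point method with flip probabilities \<open>1/2 \<plusminus> \<eta>\<close>, where \<open>\<eta> = 1 / (4 \<surd>n)\<close>. Since the
  noise has the same law under every \<open>\<delta>\<close>, the observation passes the sign path through a channel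
  that does not depend on \<open>\<delta>\<close>, so it suffices to bound the overlap of the two path laws. The flips
  are independent Bernoulli variables, hence the Bhattacharyya coefficient of the path laws is
  \<open>(1 - 4 \<eta>\<^sup>2)\<^bsup>n/2\<^esup>\<close>, and by Cauchy--Schwarz the overlap is at least half its square.
\<close>

section \<open>Overlap of two mass functions\<close>

text \<open>Since \<open>p x * q x\<close> is the product of the minimum and the maximum,
  Cauchy-Schwarz bounds the squared Bhattacharyya sum by the sum of minima times the sum of maxima.
  The latter is at most the total mass of \<open>p\<close> and \<open>q\<close>, hence at most
  2.\<close>

lemma sum_min_ge_half_square_sum_sqrt:
  fixes p q :: "'a \<Rightarrow> real"
  assumes p: "\<And>x. x \<in> A \<Longrightarrow> 0 \<le> p x" and q: "\<And>x. x \<in> A \<Longrightarrow> 0 \<le> q x"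
    and sp: "sum p A \<le> 1" and sq: "sum q A \<le> 1"
  shows "(\<Sum>x\<in>A. sqrt (p x * q x))\<^sup>2 / 2 \<le> (\<Sum>x\<in>A. min (p x) (q x))"
proof -
  have "(\<Sum>x\<in>A. sqrt (p x * q x)) = (\<Sum>x\<in>A. sqrt (min (p x) (q x)) * sqrt (max (p x) (q x)))"
    by (intro sum.cong refl) (auto simp: real_sqrt_mult min_def max_def)
  then have "(\<Sum>x\<in>A. sqrt (p x * q x))\<^sup>2
      \<le> (\<Sum>x\<in>A. (sqrt (min (p x) (q x)))\<^sup>2) * (\<Sum>x\<in>A. (sqrt (max (p x) (q x)))\<^sup>2)"
    by (simp add: Cauchy_Schwarz_ineq_sum)
  also have "\<dots> = (\<Sum>x\<in>A. min (p x) (q x)) * (\<Sum>x\<in>A. max (p x) (q x))"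
    using p q by (intro arg_cong2[where f = "(*)"] sum.cong refl) (auto simp: max_def)
  also have "\<dots> \<le> (\<Sum>x\<in>A. min (p x) (q x)) * 2"
  proof (rule mult_left_mono)
    have "(\<Sum>x\<in>A. max (p x) (q x)) \<le> (\<Sum>x\<in>A. p x + q x)"
      using p q by (intro sum_mono) (auto simp: max_def)
    then show "(\<Sum>x\<in>A. max (p x) (q x)) \<le> 2"
      using sp sq by (simp add: sum.distrib)
  qed (use p q in \<open>auto intro!: sum_nonneg\<close>)
  finally show ?thesis by simp
qed

text \<open>Used to pass from a bound on the sum of two risks to a bound on their supremum. The
  supremum may be infinite, which is why the factor 2 is cancelled by cases.\<close>

lemma ennreal_le_if_double_le:
  assumes "ennreal (2 * a) \<le> x + x" "0 \<le> a"
  shows "ennreal a \<le> x"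
  using assms by (cases x) (auto simp flip: ennreal_plus)

section \<open>Law of the sign path\<close>

definition path_prob :: "real \<Rightarrow> nat \<Rightarrow> (nat \<Rightarrow> real) \<Rightarrow> real" where
  "path_prob \<delta> n s = 1 / 2 * (\<Prod>i\<in>{1..n}. if s i = s (i - 1) then 1 - \<delta> else \<delta>)"

text \<open>Extensional functions are taken so that the set is finite and each path is counted
  once.\<close>

abbreviation sign_paths :: "nat \<Rightarrow> (nat \<Rightarrow> real) set" where
  "sign_paths n \<equiv> {0..n} \<rightarrow>\<^sub>E {-1, 1}"

lemma sign_path_mem: "s \<in> sign_paths n \<Longrightarrow> i \<le> n \<Longrightarrow> s i \<in> {-1, 1}"
  by (rule PiE_mem[of s "{0..n}" "\<lambda>_. {-1, 1}"]) simp_all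

lemma path_prob_nonneg: "0 \<le> \<delta> \<Longrightarrow> \<delta> \<le> 1 \<Longrightarrow> 0 \<le> path_prob \<delta> n s"
  by (auto simp: path_prob_def intro!: prod_nonneg)

text \<open>A stay contributes \<open>(1/2 + \<eta>) * (1/2 - \<eta>)\<close>, and a flip
  contributes the same two factors in the other order. The product is thus the same for all paths,
  which is the benefit of placing the two flip probabilities symmetrically about 1/2.\<close>

lemma path_prob_mult_symmetric:
  "path_prob (1 / 2 - \<eta>) n s * path_prob (1 / 2 + \<eta>) n s = (1 / 2)\<^sup>2 * (1 / 4 - \<eta>\<^sup>2) ^ n"
proof -
  have "path_prob (1 / 2 - \<eta>) n s * path_prob (1 / 2 + \<eta>) n s
      = (1 / 2)\<^sup>2 * (\<Prod>i\<in>{1..n}. (if s i = s (i - 1) then 1 - (1 / 2 - \<eta>) else 1 / 2 - \<eta>)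
          * (if s i = s (i - 1) then 1 - (1 / 2 + \<eta>) else 1 / 2 + \<eta>))"
    unfolding path_prob_def prod.distrib by (simp add: power2_eq_square)
  also have "\<dots> = (1 / 2)\<^sup>2 * (\<Prod>i\<in>{1..n}. 1 / 4 - \<eta>\<^sup>2)"
    by (intro arg_cong2[where f = "(*)"] prod.cong refl)
       (auto simp: power2_eq_square algebra_simps)
  finally show ?thesis by simp
qed

lemma (in sign_chain) sets_path:
  assumes "k \<le> n"
  shows "{\<omega> \<in> space M. \<forall>j\<le>k. S j \<omega> = s j} \<in> events"
proof -
  have "{\<omega> \<in> space M. S j \<omega> = s j} \<in> events" if "j \<in> {..k}" for j
    using measurable_sets[OF S_measurable[of j], of "{s j}"] that assms
    by (simp add: vimage_def Int_def conj_commute)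
  then have "{\<omega> \<in> space M. \<forall>j\<in>{..k}. S j \<omega> = s j} \<in> events"
    by (intro sets.sets_Collect_finite_All') auto
  then show ?thesis unfolding Ball_def atMost_iff .
qed

text \<open>By induction on the length: the chain rule multiplies the probability of the past by the
  conditional probability of one more stay or flip.\<close>

lemma (in sign_chain) prob_path:
  assumes "k \<le> n" "\<And>i. i \<le> k \<Longrightarrow> s i \<in> {-1, 1}"
  shows "\<P>(\<omega> in M. \<forall>j\<le>k. S j \<omega> = s j) = path_prob \<delta> k s"
  using assms
proof (induction k)
  case 0
  have meas: "{\<omega> \<in> space M. S 0 \<omega> = 1} \<in> events"
    using S_measurable[of 0] by measurable
  have "\<P>(\<omega> in M. S 0 \<omega> = -1) = prob (space M - {\<omega> \<in> space M. S 0 \<omega> = 1})"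
    using S_sign[of 0] by (intro arg_cong[where f = prob]) force
  also have "\<dots> = 1 / 2"
    using prob_compl[OF meas] S_initial by simp
  finally have "\<P>(\<omega> in M. S 0 \<omega> = -1) = 1 / 2" .
  moreover have "s 0 = -1 \<or> s 0 = 1" using 0 by auto
  ultimately show ?case using S_initial by (auto simp: path_prob_def)
next
  case (Suc k)
  let ?past = "{\<omega> \<in> space M. \<forall>j<Suc k. S j \<omega> = s j}"
  let ?path = "{\<omega> \<in> space M. \<forall>j\<le>Suc k. S j \<omega> = s j}"
  let ?step = "if s (Suc k) = s k then 1 - \<delta> else \<delta>"
  have past: "prob ?past = path_prob \<delta> k s"
    unfolding less_Suc_eq_le by (rule Suc.IH) (use Suc.prems in auto)
  have "prob ?path = prob ?past * ?step"
  proof (cases "prob ?past = 0")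
    case True
    \<comment> \<open>A null past carries no information on the next step, but the longer path is
      contained in it and so is null as well.\<close>
    have "prob ?path \<le> prob ?past"
    proof (rule finite_measure_mono)
      show "?path \<subseteq> ?past" by auto
      show "?past \<in> events"
        unfolding less_Suc_eq_le by (rule sets_path) (use Suc.prems(1) in simp)
    qed
    then show ?thesis using True using measure_nonneg[of M ?path] by simp
  next
    case False
    then have pos: "\<P>(\<omega> in M. \<forall>j<Suc k. S j \<omega> = s j) > 0"
      using measure_nonneg[of M ?past] by linarith
    have sgn: "s k = -1 \<or> s k = 1" "s (Suc k) = -1 \<or> s (Suc k) = 1"
      using Suc.prems(2)[of k] Suc.prems(2)[of "Suc k"] by auto
    show ?thesis
    proof (cases "s (Suc k) = s k")
      case True
      have "?path = {\<omega> \<in> space M. S (Suc k) \<omega> = S (Suc k - 1) \<omega> \<and> (\<forall>j<Suc k. S j \<omega> = s j)}"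
        using True by (auto simp: le_Suc_eq less_Suc_eq_le)
      then show ?thesis
        using S_stay[OF _ _ pos] Suc.prems(1) True pos by (simp add: cond_prob_def field_simps)
    next
      case False
      \<comment> \<open>With only two signs, different means opposite, so the \<open>else\<close>
        branch of \<open>path_prob\<close> is the flip event.\<close>
      then have "s (Suc k) = - s k" using sgn by auto
      then have "?path = {\<omega> \<in> space M. S (Suc k) \<omega> = - S (Suc k - 1) \<omega> \<and> (\<forall>j<Suc k. S j \<omega> = s j)}"
        by (auto simp: le_Suc_eq less_Suc_eq_le)
      then show ?thesis
        using S_flip[OF _ _ pos] Suc.prems(1) False pos by (simp add: cond_prob_def field_simps)
    qed
  qed
  also have "\<dots> = path_prob \<delta> (Suc k) s"
    unfolding past by (simp add: path_prob_def atLeastAtMostSuc_conv mult.commute)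
  finally show ?case .
qed

text \<open>The events of following a given path partition the sample space, so the total mass is
  read off from the chain rather than computed from the product.\<close>

lemma (in sign_chain) sum_path_prob: "(\<Sum>s\<in>sign_paths n. path_prob \<delta> n s) = 1"
proof -
  let ?E = "\<lambda>s. {\<omega> \<in> space M. \<forall>j\<le>n. S j \<omega> = s j}"
  have fin: "finite (sign_paths n)" by (intro finite_PiE) auto
  have disj: "disjoint_family_on ?E (sign_paths n)"
  proof (clarsimp simp: disjoint_family_on_def, rule ccontr)
    fix s s' assume s: "s \<in> sign_paths n" "s' \<in> sign_paths n" "s \<noteq> s'"
      and "?E s \<inter> ?E s' \<noteq> {}"
    then have "s j = s' j" if "j \<in> {0..n}" for j using that by fastforce
    then have "s = s'" using s by (intro PiE_ext[of s "{0..n}" "\<lambda>_. {-1, 1}" s']) auto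
    then show False using s by simp
  qed
  have "(\<Union>s\<in>sign_paths n. ?E s) = space M"
  proof (intro equalityI subsetI)
    fix \<omega> assume \<omega>: "\<omega> \<in> space M"
    then have "(\<lambda>j\<in>{0..n}. S j \<omega>) \<in> sign_paths n" using S_sign by auto
    moreover have "\<omega> \<in> ?E (\<lambda>j\<in>{0..n}. S j \<omega>)" using \<omega> by auto
    ultimately show "\<omega> \<in> (\<Union>s\<in>sign_paths n. ?E s)" by blast
  qed auto
  then have "1 = prob (\<Union>s\<in>sign_paths n. ?E s)" by (simp add: prob_space)
  also have "\<dots> = (\<Sum>s\<in>sign_paths n. prob (?E s))"
    by (intro finite_measure_finite_Union fin disj image_subsetI sets_path order_refl)
  also have "\<dots> = (\<Sum>s\<in>sign_paths n. path_prob \<delta> n s)"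
    by (intro sum.cong prob_path refl order_refl sign_path_mem)
  finally show ?thesis by simp
qed

section \<open>The Gaussian noise and its independence from the signs\<close>

abbreviation noise :: "nat \<Rightarrow> (nat \<Rightarrow> real) measure" where
  "noise n \<equiv> Pi\<^sub>M {1..n} (\<lambda>_. density lborel std_normal_density)"

lemma prob_space_noise: "prob_space (noise n)"
  by (intro prob_space_PiM prob_space_normal_density) simp

lemma (in noisy_sign_chain) distr_noise:
  assumes "n \<ge> 1"
  shows "distr M (Pi\<^sub>M {1..n} (\<lambda>_. borel)) (\<lambda>\<omega>. \<lambda>i\<in>{1..n}. W i \<omega>) = noise n"
proof -
  have "distr M borel (W i) = density lborel std_normal_density" if "i \<in> {1..n}" for i
  proof -
    \<comment> \<open>Only the sigma-algebra of the target matters here, and \<open>borel\<close>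
      and \<open>lborel\<close> share it.\<close>
    have "distr M borel (W i) = distr M lborel (W i)" by (intro distr_cong) auto
    then show ?thesis using distributed_distr_eq_density[OF W_normal[OF that]] by simp
  qed
  moreover have "random_variable borel (W i)" if "i \<in> {1..n}" for i
    using distributed_measurable[OF W_normal[OF that]] by simp
  ultimately show ?thesis
    using W_indep assms by (subst (asm) indep_vars_iff_distr_eq_PiM') (auto intro!: PiM_cong)
qed

text \<open>Independence makes the joint law of signs and noise a product measure, so the integral
  factors by Fubini. The noise factor does not involve \<delta>.\<close>

lemma (in noisy_sign_chain) nn_integral_on_path:
  assumes "n \<ge> 1" and g: "g \<in> borel_measurable (Pi\<^sub>M {1..n} (\<lambda>_. borel :: real measure))"
    and s: "s \<in> sign_paths n"
  shows "(\<integral>\<^sup>+\<omega>. indicator {\<omega> \<in> space M. \<forall>j\<le>n. S j \<omega> = s j} \<omega> * g (\<lambda>i\<in>{1..n}. W i \<omega>) \<partial>M)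
    = ennreal (path_prob \<delta> n s) * (\<integral>\<^sup>+w. g w \<partial>noise n)"
proof -
  let ?PS = "Pi\<^sub>M {0..n} (\<lambda>_. borel :: real measure)"
  let ?PW = "Pi\<^sub>M {1..n} (\<lambda>_. borel :: real measure)"
  let ?X = "\<lambda>\<omega>. \<lambda>i\<in>{0..n}. S i \<omega>" and ?Y = "\<lambda>\<omega>. \<lambda>i\<in>{1..n}. W i \<omega>"
  \<comment> \<open>The path event, moved to the space of sign vectors so that the integrand becomes
    a function of the pair \<open>(?X, ?Y)\<close>.\<close>
  let ?A = "{x \<in> space ?PS. \<forall>j\<in>{0..n}. x j = s j}"
  have X: "?X \<in> measurable M ?PS" and Y: "?Y \<in> measurable M ?PW"
    using indep_var_rv1[OF S_W_indep] indep_var_rv2[OF S_W_indep] by auto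
  have A: "?A \<in> sets ?PS"
  proof (intro sets.sets_Collect_finite_All')
    show "{x \<in> space ?PS. x j = s j} \<in> sets ?PS" if "j \<in> {0..n}" for j
      using measurable_sets[OF measurable_component_singleton[OF that], of "{s j}" "\<lambda>_. borel"]
      by (simp add: vimage_def Int_def conj_commute)
  qed auto
  have joint: "distr M ?PS ?X \<Otimes>\<^sub>M distr M ?PW ?Y = distr M (?PS \<Otimes>\<^sub>M ?PW) (\<lambda>\<omega>. (?X \<omega>, ?Y \<omega>))"
    using S_W_indep by (simp add: indep_var_distribution_eq)
  interpret Y: prob_space "distr M ?PW ?Y" using Y by (rule prob_space_distr)
  have h: "(\<lambda>(x, y). indicator ?A x * g y) \<in> borel_measurable (?PS \<Otimes>\<^sub>M ?PW)"
    using A g by measurable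
  have "(\<integral>\<^sup>+\<omega>. indicator {\<omega> \<in> space M. \<forall>j\<le>n. S j \<omega> = s j} \<omega> * g (?Y \<omega>) \<partial>M)
      = (\<integral>\<^sup>+\<omega>. (\<lambda>(x, y). indicator ?A x * g y) (?X \<omega>, ?Y \<omega>) \<partial>M)"
    by (intro nn_integral_cong) (auto simp: indicator_def space_PiM)
  also have "\<dots> = (\<integral>\<^sup>+z. (\<lambda>(x, y). indicator ?A x * g y) z \<partial>distr M (?PS \<Otimes>\<^sub>M ?PW) (\<lambda>\<omega>. (?X \<omega>, ?Y \<omega>)))"
    using h
    by (intro nn_integral_distr[OF measurable_Pair[OF X Y], symmetric]) (simp only: measurable_distr_eq1)
  also have "\<dots> = (\<integral>\<^sup>+x. \<integral>\<^sup>+y. indicator ?A x * g y \<partial>distr M ?PW ?Y \<partial>distr M ?PS ?X)"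
  proof -
    have h': "(\<lambda>(x, y). indicator ?A x * g y)
        \<in> borel_measurable (distr M ?PS ?X \<Otimes>\<^sub>M distr M ?PW ?Y)"
      using h unfolding joint by (simp only: measurable_distr_eq1)
    show ?thesis
      unfolding joint[symmetric] by (subst Y.nn_integral_fst[OF h', symmetric]) simp
  qed
  also have "\<dots> = (\<integral>\<^sup>+x. indicator ?A x * (\<integral>\<^sup>+y. g y \<partial>noise n) \<partial>distr M ?PS ?X)"
    using g unfolding distr_noise[OF assms(1), symmetric] by (subst nn_integral_cmult) auto
  also have "\<dots> = emeasure (distr M ?PS ?X) ?A * (\<integral>\<^sup>+y. g y \<partial>noise n)"
    using A by (subst nn_integral_multc) auto
  also have "emeasure (distr M ?PS ?X) ?A = emeasure M {\<omega> \<in> space M. \<forall>j\<le>n. S j \<omega> = s j}"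
    unfolding emeasure_distr[OF X A]
    by (rule arg_cong[where f = "emeasure M"]) (auto simp: space_PiM)
  also have "\<dots> = ennreal (path_prob \<delta> n s)"
    unfolding emeasure_eq_measure
    by (rule arg_cong[where f = ennreal], rule prob_path[OF order_refl sign_path_mem[OF s]])
  finally show ?thesis .
qed

section \<open>The risk as a mixture over sign paths\<close>

text \<open>The risk given the sign path \<open>s\<close>: here \<delta> enters only as the value to
  be estimated, not through the law of the data.\<close>

definition path_risk :: "nat \<Rightarrow> real \<Rightarrow> real \<Rightarrow> ((nat \<Rightarrow> real) \<Rightarrow> real) \<Rightarrow> (nat \<Rightarrow> real) \<Rightarrow> ennreal" where
  "path_risk n t \<delta> est s = (\<integral>\<^sup>+w. ennreal \<bar>\<delta> - est (\<lambda>i\<in>{1..n}. t * s i + w i)\<bar> \<partial>noise n)"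

lemma measurable_path_error:
  assumes "est \<in> estimators n"
  shows "(\<lambda>w. ennreal \<bar>\<delta> - est (\<lambda>i\<in>{1..n}. t * s i + w i)\<bar>)
    \<in> borel_measurable (Pi\<^sub>M {1..n} (\<lambda>_. borel :: real measure))"
proof -
  have [measurable]: "est \<in> borel_measurable (Pi\<^sub>M {1..n} (\<lambda>_. borel))"
    using assms by (simp add: estimators_def)
  show ?thesis by measurable
qed

text \<open>Each outcome follows exactly one path, so the error splits into a finite sum over path
  indicators, and every term factors by independence.\<close>

lemma (in noisy_sign_chain) abs_risk_eq_sum_paths:
  assumes "n \<ge> 1" and est: "est \<in> estimators n"
  shows "abs_risk M (observation \<theta> n S W) \<delta> est
    = (\<Sum>s\<in>sign_paths n. ennreal (path_prob \<delta> n s) * path_risk n (norm \<theta>) \<delta> est s)"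
proof -
  let ?E = "\<lambda>s. {\<omega> \<in> space M. \<forall>j\<le>n. S j \<omega> = s j}"
  let ?g = "\<lambda>s w. ennreal \<bar>\<delta> - est (\<lambda>i\<in>{1..n}. norm \<theta> * s i + w i)\<bar>"
  have fin: "finite (sign_paths n)" by (intro finite_PiE) auto
  have Y: "(\<lambda>\<omega>. \<lambda>i\<in>{1..n}. W i \<omega>) \<in> measurable M (Pi\<^sub>M {1..n} (\<lambda>_. borel))"
    using indep_var_rv2[OF S_W_indep] .
  have pointwise: "ennreal \<bar>\<delta> - est (observation \<theta> n S W \<omega>)\<bar>
      = (\<Sum>s\<in>sign_paths n. indicator (?E s) \<omega> * ?g s (\<lambda>i\<in>{1..n}. W i \<omega>))"
    if \<omega>: "\<omega> \<in> space M" for \<omega>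
  proof -
    let ?x = "\<lambda>j\<in>{0..n}. S j \<omega>"
    have x: "?x \<in> sign_paths n" using S_sign \<omega> by auto
    \<comment> \<open>Both functions are extensional on \<open>{0..n}\<close>, so agreement there is
      equality and a single term of the sum survives.\<close>
    have iff: "(\<omega> \<in> ?E s) = (s = ?x)" if "s \<in> sign_paths n" for s
      using that \<omega> by (auto simp: fun_eq_iff PiE_def extensional_def restrict_def)
    have obs: "observation \<theta> n S W \<omega> = (\<lambda>i\<in>{1..n}. norm \<theta> * ?x i + (\<lambda>i\<in>{1..n}. W i \<omega>) i)"
      by (auto simp: observation_def restrict_def fun_eq_iff)
    have "(\<Sum>s\<in>sign_paths n. indicator (?E s) \<omega> * ?g s (\<lambda>i\<in>{1..n}. W i \<omega>))
        = (\<Sum>s\<in>sign_paths n. if s = ?x then ?g s (\<lambda>i\<in>{1..n}. W i \<omega>) else 0)"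
      by (intro sum.cong refl)
         (simp only: iff indicator_def if_distrib[where f = "\<lambda>x. x * _"]
           mult_1_left mult_zero_left of_bool_def)
    also have "\<dots> = ?g ?x (\<lambda>i\<in>{1..n}. W i \<omega>)"
      using fin x by (simp only: sum.delta if_True)
    finally show ?thesis unfolding obs by simp
  qed
  have "abs_risk M (observation \<theta> n S W) \<delta> est
      = (\<integral>\<^sup>+\<omega>. (\<Sum>s\<in>sign_paths n. indicator (?E s) \<omega> * ?g s (\<lambda>i\<in>{1..n}. W i \<omega>)) \<partial>M)"
    unfolding abs_risk_def by (intro nn_integral_cong pointwise)
  also have "\<dots> = (\<Sum>s\<in>sign_paths n. \<integral>\<^sup>+\<omega>. indicator (?E s) \<omega> * ?g s (\<lambda>i\<in>{1..n}. W i \<omega>) \<partial>M)"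
  proof (intro nn_integral_sum borel_measurable_times_ennreal borel_measurable_indicator
      sets_path order_refl)
    fix s
    show "(\<lambda>\<omega>. ?g s (\<lambda>i\<in>{1..n}. W i \<omega>)) \<in> borel_measurable M"
      by (rule measurable_compose[OF Y measurable_path_error[OF est]])
  qed
  also have "\<dots> = (\<Sum>s\<in>sign_paths n. ennreal (path_prob \<delta> n s) * path_risk n (norm \<theta>) \<delta> est s)"
    unfolding path_risk_def
    by (intro sum.cong refl nn_integral_on_path[OF assms(1) measurable_path_error[OF est]])
  finally show ?thesis .
qed

section \<open>The two-point bound\<close>

text \<open>For a fixed path both risks see the same data, so the triangle inequality holds
  pointwise and integrates against the noise law.\<close>

lemma path_risk_add_ge:
  assumes "est \<in> estimators n"
  shows "ennreal \<bar>\<delta> - \<delta>'\<bar> \<le> path_risk n t \<delta> est s + path_risk n t \<delta>' est s"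
proof -
  interpret prob_space "noise n" by (rule prob_space_noise)
  have meas: "(\<lambda>w. ennreal \<bar>d - est (\<lambda>i\<in>{1..n}. t * s i + w i)\<bar>) \<in> borel_measurable (noise n)" for d
    using measurable_path_error[OF assms] by (simp cong: measurable_cong_sets sets_PiM_cong)
  have "ennreal \<bar>\<delta> - \<delta>'\<bar> = (\<integral>\<^sup>+w. ennreal \<bar>\<delta> - \<delta>'\<bar> \<partial>noise n)"
    by (simp add: emeasure_space_1 del: One_nat_def)
  also have "\<dots> \<le> (\<integral>\<^sup>+w. ennreal \<bar>\<delta> - est (\<lambda>i\<in>{1..n}. t * s i + w i)\<bar>
      + ennreal \<bar>\<delta>' - est (\<lambda>i\<in>{1..n}. t * s i + w i)\<bar> \<partial>noise n)"
    by (intro nn_integral_mono) (simp flip: ennreal_plus)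
  also have "\<dots> = path_risk n t \<delta> est s + path_risk n t \<delta>' est s"
    unfolding path_risk_def by (rule nn_integral_add[OF meas meas])
  finally show ?thesis .
qed

text \<open>Only the mass common to both path laws is kept; on it a single estimate has to serve
  both targets. The chains may live on different probability spaces, since only their path laws
  enter.\<close>

lemma abs_risk_add_ge_overlap:
  assumes chain: "noisy_sign_chain M n \<delta> S W" and chain': "noisy_sign_chain M' n \<delta>' S' W'"
    and \<delta>: "\<delta> \<in> {0..1}" "\<delta>' \<in> {0..1}" and n: "n \<ge> 1" and est: "est \<in> estimators n"
  shows "ennreal (\<bar>\<delta> - \<delta>'\<bar> * (\<Sum>s\<in>sign_paths n. min (path_prob \<delta> n s) (path_prob \<delta>' n s)))
    \<le> abs_risk M (observation \<theta> n S W) \<delta> est + abs_risk M' (observation \<theta> n S' W') \<delta>' est"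
proof -
  let ?m = "\<lambda>s. min (path_prob \<delta> n s) (path_prob \<delta>' n s)"
  let ?R = "\<lambda>d. path_risk n (norm \<theta>) d est"
  have nonneg: "0 \<le> ?m s" for s using \<delta> by (simp add: path_prob_nonneg)
  have "ennreal (\<bar>\<delta> - \<delta>'\<bar> * (\<Sum>s\<in>sign_paths n. ?m s)) = (\<Sum>s\<in>sign_paths n. ennreal (?m s) * ennreal \<bar>\<delta> - \<delta>'\<bar>)"
    using nonneg by (simp add: sum_distrib_left mult.commute flip: ennreal_mult)
  also have "\<dots> \<le> (\<Sum>s\<in>sign_paths n. ennreal (?m s) * (?R \<delta> s + ?R \<delta>' s))"
    by (intro sum_mono mult_left_mono path_risk_add_ge est) simp
  also have "\<dots> \<le> (\<Sum>s\<in>sign_paths n. ennreal (path_prob \<delta> n s) * ?R \<delta> s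
      + ennreal (path_prob \<delta>' n s) * ?R \<delta>' s)"
    unfolding distrib_left by (intro sum_mono add_mono mult_right_mono ennreal_leI) auto
  also have "\<dots> = abs_risk M (observation \<theta> n S W) \<delta> est + abs_risk M' (observation \<theta> n S' W') \<delta>' est"
    unfolding noisy_sign_chain.abs_risk_eq_sum_paths[OF chain n est]
      noisy_sign_chain.abs_risk_eq_sum_paths[OF chain' n est] by (rule sum.distrib)
  finally show ?thesis .
qed

text \<open>All \<open>2 ^ (n + 1)\<close> terms of the Bhattacharyya sum are equal, its square is
  \<open>(1 - 4 * \<eta>\<^sup>2) ^ n\<close>, and Bernoulli's inequality makes this linear in
  \<open>n\<close>. The total masses are hypotheses because \<open>sum_path_prob\<close> is stated
  relative to a given chain.\<close>

lemma sum_min_path_prob_ge: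
  fixes n :: nat
  assumes \<eta>: "0 \<le> \<eta>" "\<eta> \<le> 1 / 2"
    and "(\<Sum>s\<in>sign_paths n. path_prob (1 / 2 - \<eta>) n s) \<le> 1"
    and "(\<Sum>s\<in>sign_paths n. path_prob (1 / 2 + \<eta>) n s) \<le> 1"
  shows "(1 - 4 * real n * \<eta>\<^sup>2) / 2
    \<le> (\<Sum>s\<in>sign_paths n. min (path_prob (1 / 2 - \<eta>) n s) (path_prob (1 / 2 + \<eta>) n s))"
proof -
  have card: "card (sign_paths n) = 2 ^ (n + 1)" by (simp add: card_PiE flip: numeral_2_eq_2)
  have "\<eta>\<^sup>2 \<le> (1 / 2)\<^sup>2" using \<eta> by (intro power_mono) auto
  \<comment> \<open>This lets the square undo the root, and it gives the condition
    \<open>-1 \<le> - 4 * \<eta>\<^sup>2\<close> of Bernoulli's inequality.\<close>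
  then have \<eta>2: "0 \<le> 1 / 4 - \<eta>\<^sup>2" by (simp add: power2_eq_square)
  have "(\<Sum>s\<in>sign_paths n. sqrt (path_prob (1 / 2 - \<eta>) n s * path_prob (1 / 2 + \<eta>) n s))\<^sup>2
      = (2 ^ (n + 1) * (1 / 2 * sqrt ((1 / 4 - \<eta>\<^sup>2) ^ n)))\<^sup>2"
    unfolding path_prob_mult_symmetric by (simp add: card real_sqrt_mult)
  also have "\<dots> = 4 ^ n * (1 / 4 - \<eta>\<^sup>2) ^ n"
  proof -
    have "(2 ^ n)\<^sup>2 = (4 :: real) ^ n" by (simp add: power2_eq_square flip: power_mult_distrib)
    then show ?thesis using \<eta>2 by (simp add: power_mult_distrib)
  qed
  also have "\<dots> = (1 + - 4 * \<eta>\<^sup>2) ^ n"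
    by (simp flip: power_mult_distrib)
  also have "\<dots> \<ge> 1 + real n * (- 4 * \<eta>\<^sup>2)"
    using \<eta>2 by (intro Bernoulli_inequality) auto
  finally show ?thesis
    using sum_min_ge_half_square_sum_sqrt[of "sign_paths n" "path_prob (1 / 2 - \<eta>) n"
        "path_prob (1 / 2 + \<eta>) n"] assms path_prob_nonneg[of _ n]
    by (simp add: mult.assoc)
qed

section \<open>The minimax lower bound\<close>

theorem proposition6:
  fixes n :: nat and \<theta> :: "real ^ 'd"
    and M :: "real \<Rightarrow> 'w measure" and S W :: "real \<Rightarrow> nat \<Rightarrow> 'w \<Rightarrow> real"
  assumes "n \<ge> 1" and "norm \<theta> \<le> 1 / sqrt 2"
    and "\<And>\<delta>. \<delta> \<in> {0..1} \<Longrightarrow> noisy_sign_chain (M \<delta>) n \<delta> (S \<delta>) (W \<delta>)"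
  shows "(INF est\<in>estimators n. SUP \<delta>\<in>{0..1}.
            abs_risk (M \<delta>) (observation \<theta> n (S \<delta>) (W \<delta>)) \<delta> est)
         \<ge> ennreal (1 / (32 * sqrt (real n)))"
proof (rule INF_greatest)
  fix est assume est: "est \<in> estimators n"
  let ?R = "\<lambda>\<delta>. abs_risk (M \<delta>) (observation \<theta> n (S \<delta>) (W \<delta>)) \<delta> est"
  let ?T = "SUP \<delta>\<in>{0..1}. ?R \<delta>"
  \<comment> \<open>A separation of order \<open>1 / sqrt n\<close> keeps
    \<open>4 * n * \<eta>\<^sup>2\<close> constant; the value 1/4 leaves an overlap of at least
    \<open>(1 - 1/4) / 2 = 3/8\<close>.\<close>
  define \<eta> where "\<eta> = 1 / (4 * sqrt (real n))"
  have \<eta>: "0 < \<eta>" "\<eta> \<le> 1 / 2" "4 * real n * \<eta>\<^sup>2 = 1 / 4"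
  proof -
    have "1 \<le> sqrt (real n)" using assms(1) by simp
    then have "2 \<le> 4 * sqrt (real n)" by linarith
    then show "0 < \<eta>" "\<eta> \<le> 1 / 2"
      using assms(1) by (simp_all add: \<eta>_def divide_le_eq)
    show "4 * real n * \<eta>\<^sup>2 = 1 / 4"
      using assms(1) by (simp add: \<eta>_def power_divide power_mult_distrib)
  qed
  define \<delta>0 \<delta>1 where "\<delta>0 = 1 / 2 - \<eta>" and "\<delta>1 = 1 / 2 + \<eta>"
  have mem: "\<delta>0 \<in> {0..1}" "\<delta>1 \<in> {0..1}" using \<eta> by (auto simp: \<delta>0_def \<delta>1_def)
  note chains = assms(3)[OF mem(1)] assms(3)[OF mem(2)]
  note sums = chains[THEN noisy_sign_chain.axioms(1), THEN sign_chain.sum_path_prob]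
  have "3 / 8 \<le> (\<Sum>s\<in>sign_paths n. min (path_prob \<delta>0 n s) (path_prob \<delta>1 n s))"
    using sum_min_path_prob_ge[of \<eta> n] \<eta> sums by (simp add: \<delta>0_def \<delta>1_def)
  then have "2 * \<eta> * (3 / 8) \<le> \<bar>\<delta>0 - \<delta>1\<bar> * (\<Sum>s\<in>sign_paths n. min (path_prob \<delta>0 n s) (path_prob \<delta>1 n s))"
    using \<eta> by (intro mult_mono) (auto simp: \<delta>0_def \<delta>1_def)
  then have "ennreal (2 * \<eta> * (3 / 8)) \<le> ?R \<delta>0 + ?R \<delta>1"
    by (rule order_trans[OF ennreal_leI abs_risk_add_ge_overlap[OF chains mem assms(1) est]])
  also have "\<dots> \<le> ?T + ?T"
    using mem by (intro add_mono SUP_upper) auto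
  finally have "ennreal (\<eta> * (3 / 8)) \<le> ?T"
    unfolding mult.assoc by (rule ennreal_le_if_double_le) (use \<eta> in simp)
  \<comment> \<open>The argument yields \<open>3 / (32 * sqrt n)\<close>; a factor 3 is given up to
    reach the stated constant.\<close>
  moreover have "ennreal (\<eta> / 8) \<le> ennreal (\<eta> * (3 / 8))"
    using \<eta> by (intro ennreal_leI) simp
  ultimately have "ennreal (\<eta> / 8) \<le> ?T" by (rule order_trans[rotated])
  moreover have "\<eta> / 8 = 1 / (32 * sqrt (real n))" by (simp add: \<eta>_def)
  ultimately show "ennreal (1 / (32 * sqrt (real n))) \<le> ?T" by (simp only:)
qed

end
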